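(* Let $k\ge 2$ and let $(v,k,1)$ be admissible. A $\mathrm{BIBD}(v,k,1)$ is Maker win (in the Maker-Breaker game) if \[ v > k(k-1)2^{k-3}+1, \] and is Breaker win if \[ v < \frac{-k+1+\sqrt{(k+1)^2+k(k-1)2^{k+2}}}{2}. \]
   Context: A $\mathrm{BIBD}(v,k,\lambda)$ is a pair $(X,\mathcal{B})$ where $X$ is a set of $v$ points and $\mathcal{B}$ is a collection of $k$-element subsets of $X$ (blocks) such that every pair of distinct points of $X$ occurs in exactly $\lambda$ blocks. The triple $(v,k,\lambda)$ is admissible if $\lambda(v-1)\equiv 0 \pmod{k-1}$ and $\lambda v(v-1)\equiv 0\pmod{k(k-1)}$. The statement concerns any $\mathrm{BIBD}(v,k,1)$ that exists. The Maker-Breaker game on a design: Maker and Breaker alternately choose points not chosen before, Maker moving first. Maker wins if he at some time has chosen all points of some block; Breaker wins if all points have been chosen and Maker has not completed a block. A design is Maker win (Breaker win) if Maker (Breaker) has a winning strategy. *)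

theory Defs
  imports Complex_Main "HOL-Library.Multiset" "HOL-Number_Theory.Cong"
begin

section \<open>Block designs\<close>

text \<open>Blocks form a multiset, so that repeated blocks are counted with multiplicity.\<close>

definition bibd :: "nat \<Rightarrow> nat \<Rightarrow> nat \<Rightarrow> 'a set \<Rightarrow> 'a set multiset \<Rightarrow> bool" where
  "bibd v k l X \<B> \<longleftrightarrow>
     finite X \<and> card X = v \<and>
     (\<forall>A\<in>#\<B>. A \<subseteq> X \<and> card A = k) \<and>
     (\<forall>x\<in>X. \<forall>y\<in>X. x \<noteq> y \<longrightarrow> size {#A \<in># \<B>. x \<in> A \<and> y \<in> A#} = l)"

definition admissible :: "nat \<Rightarrow> nat \<Rightarrow> nat \<Rightarrow> bool" where
  "admissible v k l \<longleftrightarrow>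
     [int l * (int v - 1) = 0] (mod (int k - 1)) \<and>
     [int l * int v * (int v - 1) = 0] (mod (int k * (int k - 1)))"


section \<open>The Maker-Breaker game\<close>

text \<open>
  A play is the list of the points chosen so far, oldest first; Maker moves first and
  the players alternate. A play is continued until all points are chosen, even if Maker has
  already completed a block; the moves after that point do not affect who wins.
\<close>

datatype player = Maker | Breaker

definition to_move :: "'a list \<Rightarrow> player" where
  "to_move p = (if even (length p) then Maker else Breaker)"

definition play :: "'a set \<Rightarrow> 'a list \<Rightarrow> bool" where
  "play X p \<longleftrightarrow> distinct p \<and> set p \<subseteq> X"

definition complete_play :: "'a set \<Rightarrow> 'a list \<Rightarrow> bool" where
  "complete_play X p \<longleftrightarrow> play X p \<and> set p = X"

definition chosen_by :: "player \<Rightarrow> 'a list \<Rightarrow> 'a set" where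
  "chosen_by P p = {p ! i | i. i < length p \<and> to_move (take i p) = P}"

definition completes_block :: "'a set multiset \<Rightarrow> 'a list \<Rightarrow> bool" where
  "completes_block \<B> p \<longleftrightarrow> (\<exists>n\<le>length p. \<exists>A\<in>#\<B>. A \<subseteq> chosen_by Maker (take n p))"

fun wins :: "player \<Rightarrow> 'a set \<Rightarrow> 'a set multiset \<Rightarrow> 'a list \<Rightarrow> bool" where
  "wins Maker X \<B> p \<longleftrightarrow> completes_block \<B> p"
| "wins Breaker X \<B> p \<longleftrightarrow> complete_play X p \<and> \<not> completes_block \<B> p"

text \<open>
  A strategy may depend on the whole history, and must return a legal move at every play that
  is not complete and at which the player is to move.
\<close>

definition strategy :: "'a set \<Rightarrow> player \<Rightarrow> ('a list \<Rightarrow> 'a) \<Rightarrow> bool" where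
  "strategy X P \<sigma> \<longleftrightarrow>
     (\<forall>p. play X p \<and> \<not> complete_play X p \<and> to_move p = P \<longrightarrow> \<sigma> p \<in> X - set p)"

definition follows :: "player \<Rightarrow> ('a list \<Rightarrow> 'a) \<Rightarrow> 'a list \<Rightarrow> bool" where
  "follows P \<sigma> p \<longleftrightarrow> (\<forall>i<length p. to_move (take i p) = P \<longrightarrow> p ! i = \<sigma> (take i p))"

definition winning_strategy ::
    "'a set \<Rightarrow> 'a set multiset \<Rightarrow> player \<Rightarrow> ('a list \<Rightarrow> 'a) \<Rightarrow> bool" where
  "winning_strategy X \<B> P \<sigma> \<longleftrightarrow>
     strategy X P \<sigma> \<and> (\<forall>p. complete_play X p \<and> follows P \<sigma> p \<longrightarrow> wins P X \<B> p)"

definition maker_win :: "'a set \<Rightarrow> 'a set multiset \<Rightarrow> bool" where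
  "maker_win X \<B> \<longleftrightarrow> (\<exists>\<sigma>. winning_strategy X \<B> Maker \<sigma>)"

definition breaker_win :: "'a set \<Rightarrow> 'a set multiset \<Rightarrow> bool" where
  "breaker_win X \<B> \<longleftrightarrow> (\<exists>\<sigma>. winning_strategy X \<B> Breaker \<sigma>)"

end

theory Submission
  imports Defs
begin

text \<open>
  Give a block that Breaker has not touched the weight \<open>2\<close> to the minus number of its
  points that Maker still lacks, and let the danger of a point be the weight of the blocks
  through it. Both players always take a free point of maximal danger. With \<open>b\<close> blocks in total
  and \<open>r\<close> blocks through each point, the total weight after the first move of Maker is
  \<open>(b + r) / 2^k\<close>. If it is less than \<open>1\<close>, it remains so (Erdos and Selfridge), whereas a
  completed block has weight \<open>1\<close>. Conversely, a round costs a Maker who moves greedily only the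
  weight of the blocks through the two points just chosen, hence at most \<open>1/4\<close> when \<open>\<lambda> = 1\<close>;
  so if \<open>b / 2^k > v / 8\<close>, some block survives untouched until the end (Beck).
\<close>

section \<open>Weights of block families and their change under a move\<close>

definition weight :: "'a set set \<Rightarrow> 'a set \<Rightarrow> 'a set \<Rightarrow> real" where
  "weight F M B = (\<Sum>A | A \<in> F \<and> A \<inter> B = {}. (1/2) ^ card (A - M))"

text \<open>The result is again a family of blocks, so \<open>weight (through x F) M B\<close> is
  the danger of \<open>x\<close>, and nesting gives the blocks through two points.\<close>

definition through :: "'a \<Rightarrow> 'a set set \<Rightarrow> 'a set set" where
  "through x F = {A \<in> F. x \<in> A}"

lemma in_through [simp]: "A \<in> through x F \<longleftrightarrow> A \<in> F \<and> x \<in> A"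
  by (simp add: through_def)

lemma finite_through [simp]: "finite F \<Longrightarrow> finite (through x F)"
  by (simp add: through_def)

lemma weight_nonneg: "0 \<le> weight F M B"
  by (simp add: weight_def sum_nonneg)

text \<open>Taking \<open>x\<close> lowers the exponent of each untouched block through
  \<open>x\<close> by one and so doubles its weight. The gain is what these blocks weighed
  before.\<close>

lemma weight_insert_maker:
  assumes "finite F" "\<And>A. A \<in> F \<Longrightarrow> finite A" "x \<notin> M"
  shows "weight F (insert x M) B = weight F M B + weight (through x F) M B"
proof -
  have eq: "(1/2::real) ^ card (A - insert x M) =
      (1/2) ^ card (A - M) + (if x \<in> A then (1/2) ^ card (A - M) else 0)" if "A \<in> F" for A
  proof (cases "x \<in> A")
    case True
    then have "A - M = insert x (A - insert x M)"
      using assms(3) by auto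
    then have "card (A - M) = Suc (card (A - insert x M))"
      using assms(2)[OF that] by (metis Diff_iff card_insert_disjoint finite_Diff insertI1)
    then show ?thesis
      using True by simp
  next
    case False
    then have "A - insert x M = A - M"
      by auto
    with False show ?thesis
      by simp
  qed
  let ?S = "{A \<in> F. A \<inter> B = {}}"
  have "weight F (insert x M) B =
      (\<Sum>A \<in> ?S. (1/2) ^ card (A - M) + (if x \<in> A then (1/2) ^ card (A - M) else 0))"
    unfolding weight_def by (intro sum.cong refl eq) simp
  also have "\<dots> = weight F M B + (\<Sum>A \<in> {A \<in> ?S. x \<in> A}. (1/2) ^ card (A - M))"
    using assms(1) by (subst sum.inter_filter) (simp_all add: sum.distrib weight_def)
  also have "{A \<in> ?S. x \<in> A} = {A \<in> through x F. A \<inter> B = {}}"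
    by auto
  finally show ?thesis
    by (simp only: weight_def)
qed

lemma weight_insert_breaker:
  assumes "finite F"
  shows "weight F M (insert y B) = weight F M B - weight (through y F) M B"
proof -
  have "{A \<in> F. A \<inter> B = {}} =
      {A \<in> F. A \<inter> insert y B = {}} \<union> {A \<in> through y F. A \<inter> B = {}}"
    by auto
  then have "weight F M B = weight F M (insert y B) + weight (through y F) M B"
    unfolding weight_def using assms by (simp only:) (rule sum.union_disjoint; auto)
  then show ?thesis
    by simp
qed

lemma weight_uniform:
  assumes "\<And>A. A \<in> F \<Longrightarrow> card A = k"
  shows "weight F {} {} = real (card F) / 2 ^ k"
  using assms by (simp add: weight_def power_divide)

section \<open>Plays, chosen points and strategies\<close>

lemma chosen_by_Nil [simp]: "chosen_by P [] = {}"
  by (simp add: chosen_by_def)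

lemma chosen_by_snoc [simp]:
  "chosen_by P (p @ [x]) = (if to_move p = P then insert x (chosen_by P p) else chosen_by P p)"
proof -
  let ?I = "\<lambda>q. {i. i < length q \<and> to_move (take i q) = P}"
  have image: "chosen_by P q = (\<lambda>i. q ! i) ` ?I q" for q
    by (auto simp: chosen_by_def)
  have "?I (p @ [x]) = ?I p \<union> (if to_move p = P then {length p} else {})"
    by (auto simp: less_Suc_eq)
  moreover have "(\<lambda>i. (p @ [x]) ! i) ` ?I p = (\<lambda>i. p ! i) ` ?I p"
    by (intro image_cong) (auto simp: nth_append)
  ultimately show ?thesis
    by (simp add: image image_Un)
qed

lemma to_move_Nil [simp]: "to_move [] = Maker"
  by (simp add: to_move_def)

lemma to_move_snoc [simp]:
  "to_move (p @ [x]) = (if to_move p = Maker then Breaker else Maker)"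
  by (simp add: to_move_def)

lemma chosen_by_union: "chosen_by Maker p \<union> chosen_by Breaker p = set p"
proof (induction p rule: rev_induct)
  case (snoc x p)
  then show ?case
    by (cases "to_move p") (simp_all add: snoc[symmetric])
qed simp

lemma chosen_by_subset: "chosen_by P p \<subseteq> set p"
  using chosen_by_union[of p] by (cases P) auto

lemma chosen_by_disjoint: "distinct p \<Longrightarrow> chosen_by Maker p \<inter> chosen_by Breaker p = {}"
proof (induction p rule: rev_induct)
  case (snoc x p)
  then show ?case
    using chosen_by_subset[of _ p] by auto
qed simp

text \<open>Maker never loses a point, so a block completed at some time still lies in his final
  set. The winner can be read off at the end.\<close>

lemma completes_block_iff: "completes_block \<B> p \<longleftrightarrow> (\<exists>A\<in>#\<B>. A \<subseteq> chosen_by Maker p)"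
proof -
  have "chosen_by Maker (take n p) \<subseteq> chosen_by Maker p" for n
    by (auto simp: chosen_by_def min_def split: if_splits)
  then show ?thesis
    unfolding completes_block_def by (metis order_refl order_trans take_all)
qed

text \<open>Reduces the construction of a strategy to a property of plays: the opponent cannot
  destroy it, and player \<open>P\<close> always has a move that keeps it. Such a move is picked by
  choice.\<close>

lemma winning_strategy_from_invariant:
  assumes init: "Inv []"
    and opp: "\<And>p x. \<lbrakk>play X p; to_move p \<noteq> P; x \<in> X - set p; Inv p\<rbrakk> \<Longrightarrow> Inv (p @ [x])"
    and own: "\<And>p. \<lbrakk>play X p; to_move p = P; X - set p \<noteq> {}; Inv p\<rbrakk>
                \<Longrightarrow> \<exists>x \<in> X - set p. Inv (p @ [x])"
    and final: "\<And>p. \<lbrakk>complete_play X p; Inv p\<rbrakk> \<Longrightarrow> wins P X \<B> p"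
  shows "\<exists>\<sigma>. winning_strategy X \<B> P \<sigma>"
proof -
  \<comment> \<open>\<open>strategy\<close> demands a legal move at every play, also where no move
    gives \<open>Inv\<close>; the second \<open>SOME\<close> supplies one there.\<close>
  define \<sigma> where "\<sigma> p = (if \<exists>x \<in> X - set p. Inv (p @ [x])
      then SOME x. x \<in> X - set p \<and> Inv (p @ [x]) else SOME x. x \<in> X - set p)" for p
  have good: "\<sigma> p \<in> X - set p \<and> Inv (p @ [\<sigma> p])" if "\<exists>x \<in> X - set p. Inv (p @ [x])" for p
    using someI_ex[of "\<lambda>x. x \<in> X - set p \<and> Inv (p @ [x])"] that unfolding \<sigma>_def by auto
  have legal: "\<sigma> p \<in> X - set p" if "X - set p \<noteq> {}" for p
  proof (cases "\<exists>x \<in> X - set p. Inv (p @ [x])")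
    case False
    then show ?thesis
      using someI_ex[of "\<lambda>x. x \<in> X - set p"] that unfolding \<sigma>_def by (simp only: if_False) blast
  qed (use good in blast)
  have inv: "Inv p" if "play X p" "follows P \<sigma> p" for p
    using that
  proof (induction p rule: rev_induct)
    case (snoc x p)
    have p: "play X p" "x \<in> X - set p"
      using snoc.prems(1) by (auto simp: play_def)
    have "follows P \<sigma> p"
      using snoc.prems(2) unfolding follows_def
      by (metis length_append_singleton less_Suc_eq less_imp_le_nat nth_append take_append
          append_Nil2 diff_is_0_eq take_0)
    then have "Inv p"
      using snoc.IH p by blast
    show ?case
    proof (cases "to_move p = P")
      case True
      then have "x = \<sigma> p"
        using snoc.prems(2) unfolding follows_def by (auto dest: spec[of _ "length p"])
      then show ?thesis
        using good own[OF p(1) True _ \<open>Inv p\<close>] p(2) by blast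
    qed (use opp p \<open>Inv p\<close> in blast)
  qed (simp add: init)
  have "strategy X P \<sigma>"
    using legal unfolding strategy_def complete_play_def play_def by blast
  moreover have "wins P X \<B> p" if "complete_play X p" "follows P \<sigma> p" for p
    using that inv final by (auto simp: complete_play_def)
  ultimately show ?thesis
    unfolding winning_strategy_def by blast
qed

section \<open>Greedy play: the two weight criteria\<close>

lemma obtain_max_weight_point:
  assumes "finite S" "S \<noteq> {}"
  obtains x where "x \<in> S"
    "\<And>y. y \<in> S \<Longrightarrow> weight (through y F) M B \<le> weight (through x F) M B"
proof -
  let ?w = "\<lambda>x. weight (through x F) M B"
  have "Max (?w ` S) \<in> ?w ` S"
    using assms by (intro Max_in) auto
  then obtain x where "x \<in> S" "?w x = Max (?w ` S)"
    by auto
  with assms(1) show ?thesis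
    by (intro that[of x]) auto
qed

text \<open>By taking the most dangerous point, Breaker removes at least as much weight as the next
  move of Maker can add. Hence only the first move of Maker has to be bounded in advance;
  \<open>init\<close> covers a game without points.\<close>

lemma breaker_win_Erdos_Selfridge:
  assumes X: "finite X" and F: "\<And>A. A \<in># \<B> \<Longrightarrow> A \<subseteq> X"
    and init: "weight (set_mset \<B>) {} {} < 1"
    and first: "\<And>x. x \<in> X \<Longrightarrow>
      weight (set_mset \<B>) {} {} + weight (through x (set_mset \<B>)) {} {} < 1"
  shows "breaker_win X \<B>"
proof -
  let ?F = "set_mset \<B>" and ?M = "chosen_by Maker" and ?B = "chosen_by Breaker"
  have fin: "A \<in> ?F \<Longrightarrow> finite A" for A
    using F X finite_subset by metis
  define T where "T p = weight ?F (?M p) (?B p)" for p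
  define W where "W p x = weight (through x ?F) (?M p) (?B p)" for p x
  \<comment> \<open>With Maker to move, the bound already allows for whatever he takes next.
    \<open>T p < 1\<close> is stated separately, since at a complete play no \<open>x\<close> is
    left.\<close>
  define Inv where "Inv p \<longleftrightarrow>
      T p < 1 \<and> (to_move p = Maker \<longrightarrow> (\<forall>x \<in> X - set p. T p + W p x < 1))" for p
  show ?thesis
    unfolding breaker_win_def
  proof (rule winning_strategy_from_invariant[where Inv = Inv])
    show "Inv []"
      using init first by (simp add: Inv_def T_def W_def)
  next
    fix p x assume *: "play X p" "to_move p \<noteq> Breaker" "x \<in> X - set p" "Inv p"
    then have maker: "to_move p = Maker"
      by (metis player.exhaust)
    have "x \<notin> ?M p"
      using * chosen_by_subset by fastforce
    with * maker show "Inv (p @ [x])"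
      by (simp add: Inv_def T_def W_def weight_insert_maker fin)
  next
    fix p assume *: "play X p" "to_move p = Breaker" "X - set p \<noteq> {}" "Inv p"
    obtain y where y: "y \<in> X - set p" "\<And>x. x \<in> X - set p \<Longrightarrow> W p x \<le> W p y"
      unfolding W_def by (rule obtain_max_weight_point[OF _ *(3)]) (use X in auto)
    have T: "T (p @ [y]) = T p - W p y"
      by (simp add: T_def W_def *(2) weight_insert_breaker)
    have W: "W (p @ [y]) x \<le> W p x" for x
      by (simp add: W_def *(2) weight_insert_breaker weight_nonneg)
    have "0 \<le> W p y"
      by (simp add: W_def weight_nonneg)
    moreover have "T p < 1"
      using *(4) by (simp add: Inv_def)
    \<comment> \<open>The new total is at most \<open>T p - W p y + W p x\<close>, and
      \<open>W p x \<le> W p y\<close> by the choice of \<open>y\<close>.\<close>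
    moreover have "T (p @ [y]) + W (p @ [y]) x < 1" if "x \<in> X - set p" for x
      using T W[of x] y(2)[OF that] \<open>T p < 1\<close> by linarith
    ultimately have "Inv (p @ [y])"
      by (auto simp: Inv_def T)
    with y show "\<exists>y \<in> X - set p. Inv (p @ [y])"
      by blast
  next
    fix p assume *: "complete_play X p" "Inv p"
    have "\<not> A \<subseteq> ?M p" if A: "A \<in> ?F" for A
    proof
      assume sub: "A \<subseteq> ?M p"
      then have "A \<inter> ?B p = {}"
        using chosen_by_disjoint[of p] * by (auto simp: complete_play_def play_def)
      then have "(1/2) ^ card (A - ?M p) \<le> T p"
        unfolding T_def weight_def using A by (intro member_le_sum) auto
      moreover have "A - ?M p = {}"
        using sub by blast
      ultimately show False
        using * by (simp add: Inv_def)
    qed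
    then show "wins Breaker X \<B> p"
      using * by (auto simp: completes_block_iff)
  qed
qed

text \<open>If Maker takes \<open>x\<close> and Breaker then \<open>y\<close>, the total changes by
  the danger of \<open>x\<close> minus the new danger of \<open>y\<close>. By the choice of
  \<open>x\<close>, the loss is at most the old weight of the at most \<open>d\<close> blocks
  through both, thus at most \<open>d / 4\<close> for two points, or \<open>d / 8\<close> per
  point.\<close>

lemma maker_win_Beck:
  assumes X: "finite X" and F: "\<And>A. A \<in># \<B> \<Longrightarrow> A \<subseteq> X"
    and pair: "\<And>x y. \<lbrakk>x \<in> X; y \<in> X; x \<noteq> y\<rbrakk>
                 \<Longrightarrow> card (through x (through y (set_mset \<B>))) \<le> d"
    and init: "real d * real (card X) / 8 < weight (set_mset \<B>) {} {}"
  shows "maker_win X \<B>"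
proof -
  let ?F = "set_mset \<B>" and ?M = "chosen_by Maker" and ?B = "chosen_by Breaker"
  have fin: "A \<in> ?F \<Longrightarrow> finite A" for A
    using F X finite_subset by metis
  define T where "T p = weight ?F (?M p) (?B p)" for p
  define W where "W p x = weight (through x ?F) (?M p) (?B p)" for p x
  \<comment> \<open>Lower bound for the total weight when \<open>n\<close> points have been chosen, \<open>n\<close> even.\<close>
  define L where "L n = real d * (real (card X) - real n) / 8" for n
  \<comment> \<open>After a move of Maker the bound for the preceding even length still holds, and
    any reply of Breaker must leave the bound for the following one. The former is what remains if
    the play ends with Maker's move, when no reply exists.\<close>
  define Inv where "Inv p \<longleftrightarrow> (if to_move p = Maker then L (length p) < T p
      else L (length p - 1) < T p \<and> (\<forall>y \<in> X - set p. L (length p + 1) < T p - W p y))" for p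
  show ?thesis
    unfolding maker_win_def
  proof (rule winning_strategy_from_invariant[where Inv = Inv])
    show "Inv []"
      using init by (simp add: Inv_def T_def L_def)
  next
    fix p y assume "play X p" "to_move p \<noteq> Maker" "y \<in> X - set p" "Inv p"
    moreover from this have "to_move p = Breaker"
      by (metis player.exhaust)
    ultimately show "Inv (p @ [y])"
      by (simp add: Inv_def T_def W_def weight_insert_breaker)
  next
    fix p assume *: "play X p" "to_move p = Maker" "X - set p \<noteq> {}" "Inv p"
    obtain x where x: "x \<in> X - set p" "\<And>y. y \<in> X - set p \<Longrightarrow> W p y \<le> W p x"
      unfolding W_def by (rule obtain_max_weight_point[OF _ *(3)]) (use X in auto)
    have xM: "x \<notin> ?M p"
      using x chosen_by_subset by fastforce
    have T: "T (p @ [x]) = T p + W p x"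
      by (simp add: T_def W_def *(2) weight_insert_maker fin xM)
    have "L (length p) < T p"
      using * by (simp add: Inv_def)
    moreover have "0 \<le> W p x"
      by (simp add: W_def weight_nonneg)
    moreover have "L (length p + 2) < T (p @ [x]) - W (p @ [x]) y"
      if y: "y \<in> X - set (p @ [x])" for y
    proof -
      let ?G = "through x (through y ?F)"
      have yM: "y \<notin> ?M p"
        using y chosen_by_subset by fastforce
      \<comment> \<open>At \<open>p\<close>, before the round, Maker has neither \<open>x\<close>
        nor \<open>y\<close>, so each block through both lacks at least two points.\<close>
      have le: "(1/2::real) ^ card (A - ?M p) \<le> 1/4" if A: "A \<in> ?G" for A
      proof -
        have "{x, y} \<subseteq> A - ?M p" "x \<noteq> y"
          using A y xM yM by auto
        then have "2 \<le> card (A - ?M p)"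
          using card_mono[of "A - ?M p" "{x, y}"] fin A by auto
        then have "(1/2::real) ^ card (A - ?M p) \<le> (1/2) ^ 2"
          by (rule power_decreasing) auto
        then show ?thesis
          by (simp add: power2_eq_square)
      qed
      have "weight ?G (?M p) (?B p) \<le> real (card {A \<in> ?G. A \<inter> ?B p = {}}) * (1/4)"
        unfolding weight_def by (rule sum_bounded_above) (use le in auto)
      also have "\<dots> \<le> real (card ?G) * (1/4)"
        by (intro mult_right_mono of_nat_mono card_mono) auto
      also have "\<dots> \<le> real d * (1/4)"
        using pair[of x y] x y by (intro mult_right_mono of_nat_mono) auto
      finally have "weight ?G (?M p) (?B p) \<le> real d / 4"
        by simp
      \<comment> \<open>Maker's move at \<open>x\<close> doubles the blocks through both points,
        which raises the danger of \<open>y\<close> by their weight.\<close>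
      moreover have "W (p @ [x]) y = W p y + weight ?G (?M p) (?B p)"
        using weight_insert_maker[of "through y ?F" x "?M p" "?B p"] fin xM
        by (simp add: W_def *(2))
      moreover have "W p y \<le> W p x"
        using x y by auto
      moreover have "L (length p + 2) = L (length p) - real d / 4"
        by (simp add: L_def field_simps)
      ultimately show ?thesis
        using T \<open>L (length p) < T p\<close> by linarith
    qed
    ultimately have "Inv (p @ [x])"
      by (simp add: Inv_def *(2) T)
    with x show "\<exists>x \<in> X - set p. Inv (p @ [x])"
      by blast
  next
    fix p assume *: "complete_play X p" "Inv p"
    \<comment> \<open>At the end \<open>L\<close> has come down to \<open>0\<close>, or to
      \<open>d / 8\<close> one point earlier, so the total is positive and some block is untouched.
      All its points are Maker's.\<close>
    then have "length p = card X"
      by (metis complete_play_def distinct_card play_def)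
    then have "L (length p) < T p \<or> L (length p - 1) < T p"
        "0 \<le> L (length p)" "0 \<le> L (length p - 1)"
      using *(2) by (auto simp: Inv_def L_def split: if_splits)
    then have "0 < T p"
      by linarith
    then obtain A where A: "A \<in> ?F" "A \<inter> ?B p = {}"
      unfolding T_def weight_def by (metis (mono_tags, lifting) empty_Collect_eq less_irrefl sum.empty)
    then have "A \<subseteq> ?M p"
      using F[of A] chosen_by_union[of p] * by (auto simp: complete_play_def)
    with A show "wins Maker X \<B> p"
      by (auto simp: completes_block_iff)
  qed
qed

section \<open>Counting blocks for \<lambda> = 1\<close>

lemma bibd_pair:
  assumes "bibd v k 1 X \<B>" "x \<in> X" "y \<in> X" "x \<noteq> y"
  obtains A where "through x (through y (set_mset \<B>)) = {A}"
proof -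
  have "size {#A \<in># \<B>. x \<in> A \<and> y \<in> A#} = 1"
    using assms by (simp add: bibd_def)
  \<comment> \<open>A multiset of size 1 has just one element, so the pair condition survives the
    passage from \<open>\<B>\<close> to \<open>set_mset \<B>\<close>.\<close>
  then obtain A where "{#A \<in># \<B>. x \<in> A \<and> y \<in> A#} = {#A#}"
    using size_1_singleton_mset by blast
  then have "{A'. A' \<in># \<B> \<and> x \<in> A' \<and> y \<in> A'} = {A}"
    by (metis set_mset_filter set_mset_single)
  moreover have "through x (through y (set_mset \<B>)) = {A'. A' \<in># \<B> \<and> x \<in> A' \<and> y \<in> A'}"
    by auto
  ultimately show ?thesis
    using that by simp
qed

text \<open>The blocks through \<open>x\<close>, with \<open>x\<close> removed, partition the other
  points: each \<open>y\<close> lies in one of them, and two that share \<open>y\<close> coincide by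
  \<open>bibd_pair\<close>.\<close>

lemma bibd_replication:
  assumes bibd: "bibd v k 1 X \<B>" and x: "x \<in> X"
  shows "card (through x (set_mset \<B>)) * (k - 1) = v - 1"
proof -
  let ?R = "through x (set_mset \<B>)"
  have X: "finite X" "card X = v"
    using bibd by (auto simp: bibd_def)
  have F: "A \<subseteq> X" "card A = k" if "A \<in> ?R" for A
    using bibd that by (auto simp: bibd_def)
  have fin: "finite A" if "A \<in> ?R" for A
    using F[OF that] X finite_subset by blast
  have "y \<in> (\<Union>A \<in> ?R. A - {x})" if y: "y \<in> X - {x}" for y
  proof -
    obtain A where "through x (through y (set_mset \<B>)) = {A}"
      using bibd_pair[OF bibd x, of y] y by (metis DiffD1 DiffD2 singletonI)
    then have "A \<in> through x (through y (set_mset \<B>))"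
      by simp
    then have "A \<in> ?R" "y \<in> A"
      by simp_all
    with y show ?thesis
      by blast
  qed
  then have "X - {x} = (\<Union>A \<in> ?R. A - {x})"
    using F(1) by blast
  then have "v - 1 = card (\<Union>A \<in> ?R. A - {x})"
    using X x by (metis card_Diff_singleton)
  also have "\<dots> = (\<Sum>A \<in> ?R. card (A - {x}))"
  proof (rule card_UN_disjoint)
    show "\<forall>A \<in> ?R. finite (A - {x})"
      using fin by blast
    have "A = A'" if "A \<in> ?R" "A' \<in> ?R" "y \<in> A" "y \<in> A'" "y \<noteq> x" for A A' y
    proof -
      have "y \<in> X" "x \<noteq> y"
        using F(1)[OF that(1)] that by auto
      then obtain C where "through x (through y (set_mset \<B>)) = {C}"
        using bibd_pair[OF bibd x] by metis
      moreover have "A \<in> through x (through y (set_mset \<B>))"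
          "A' \<in> through x (through y (set_mset \<B>))"
        using that by simp_all
      ultimately show ?thesis
        by (metis singletonD)
    qed
    then show "\<forall>A \<in> ?R. \<forall>A' \<in> ?R. A \<noteq> A' \<longrightarrow> (A - {x}) \<inter> (A' - {x}) = {}"
      by blast
  qed simp
  also have "\<dots> = (\<Sum>A \<in> ?R. k - 1)"
    using F fin by (intro sum.cong) (auto simp: card_Diff_singleton)
  finally show ?thesis
    by simp
qed

text \<open>Double counting of the incidences of points and blocks; the factor \<open>k - 1\<close>
  lets \<open>bibd_replication\<close> be applied without division.\<close>

lemma bibd_block_count:
  assumes bibd: "bibd v k 1 X \<B>"
  shows "card (set_mset \<B>) * k * (k - 1) = v * (v - 1)"
proof -
  let ?F = "set_mset \<B>"
  have X: "finite X" "card X = v"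
    using bibd by (auto simp: bibd_def)
  have F: "A \<subseteq> X" "card A = k" if "A \<in># \<B>" for A
    using bibd that by (auto simp: bibd_def)
  have "card ?F * k = (\<Sum>A \<in> ?F. card {x \<in> X. x \<in> A})"
  proof -
    have "card {x \<in> X. x \<in> A} = k" if "A \<in> ?F" for A
      using F[OF that] by (simp add: Collect_conj_eq Int_absorb1)
    then show ?thesis
      by simp
  qed
  also have "\<dots> = (\<Sum>x \<in> X. card (through x ?F))"
    unfolding through_def using X by (intro sum_multicount_gen[symmetric]) auto
  finally have "card ?F * k * (k - 1) = (\<Sum>x \<in> X. card (through x ?F) * (k - 1))"
    by (simp add: sum_distrib_right)
  also have "\<dots> = v * (v - 1)"
    using bibd_replication[OF bibd] X by simp
  finally show ?thesis .
qed

section \<open>The two bounds on the number of points\<close>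

theorem lemma2p1:
  fixes v k :: nat and X :: "'a set" and \<B> :: "'a set multiset"
  assumes "k \<ge> 2"
    and "admissible v k 1"
    and "bibd v k 1 X \<B>"
  shows "(real v > real k * (real k - 1) * 2 powi (int k - 3) + 1 \<longrightarrow> maker_win X \<B>) \<and>
    (real v < (- real k + 1 + sqrt ((real k + 1)\<^sup>2 + real k * (real k - 1) * 2 ^ (k + 2))) / 2
      \<longrightarrow> breaker_win X \<B>)"
proof -
  let ?F = "set_mset \<B>"
  have X: "finite X" "card X = v"
    using assms(3) by (auto simp: bibd_def)
  have F: "A \<subseteq> X" "card A = k" if "A \<in># \<B>" for A
    using assms(3) that by (auto simp: bibd_def)
  define b where "b = real (card ?F)"
  define c where "c = real k * (real k - 1)"
  have c: "0 < c"
    using assms(1) by (simp add: c_def)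
  have wF: "weight ?F {} {} = b / 2 ^ k"
    unfolding b_def by (rule weight_uniform) (use F in auto)
  have b: "b * c = real v * (real v - 1)"
  proof -
    have "real (card ?F * k * (k - 1)) = real (v * (v - 1))"
      using bibd_block_count[OF assms(3)] by simp
    then show ?thesis
      using assms(1) by (cases "v = 0") (auto simp: b_def c_def of_nat_diff)
  qed
  have maker: "maker_win X \<B>" if v: "real v > c * 2 powi (int k - 3) + 1"
  proof (rule maker_win_Beck[where d = 1])
    fix x y assume "x \<in> X" "y \<in> X" "x \<noteq> y"
    then obtain A where "through x (through y ?F) = {A}"
      using bibd_pair[OF assms(3)] by metis
    then show "card (through x (through y ?F)) \<le> 1"
      by simp
  next
    \<comment> \<open>The exponent is an integer because it is negative for
      \<open>k = 2\<close>.\<close>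
    have powi: "2 powi (int k - 3) = (2::real) ^ k / 8"
      by (simp add: power_int_diff)
    have *: "c * 2 ^ k / 8 < real v - 1"
      using v unfolding powi by simp
    moreover have "0 < c * 2 ^ k / 8"
      using c by simp
    then have "0 < real v"
      using * by linarith
    \<comment> \<open>Multiplied by \<open>v\<close>, the hypothesis becomes
      \<open>b / 2 ^ k > v / 8\<close> by way of \<open>b * c = v * (v - 1)\<close>.\<close>
    ultimately have "real v * (c * 2 ^ k / 8) < real v * (real v - 1)"
      by (intro mult_strict_left_mono)
    also have "\<dots> = b * c"
      by (simp add: b)
    finally have "c * (real v * 2 ^ k / 8) < c * b"
      by (simp add: algebra_simps)
    then have "real v * 2 ^ k / 8 < b"
      using c by simp
    then show "real 1 * real (card X) / 8 < weight ?F {} {}"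
      by (simp add: X wF field_simps)
  qed (use X F in auto)
  have breaker: "breaker_win X \<B>"
    if v: "real v < (- real k + 1 + sqrt ((real k + 1)\<^sup>2 + c * 2 ^ (k + 2))) / 2"
  \<comment> \<open>Without points there are no blocks, as \<open>k \<ge> 2\<close>. Otherwise a
    first move exists and \<open>v - 1\<close> is not truncated.\<close>
  proof (cases "v = 0")
    case True
    then have "?F = {}"
      using F X assms(1) by fastforce
    then show ?thesis
      using True X by (intro breaker_win_Erdos_Selfridge) (auto simp: weight_def)
  next
    case False
    define s where "s = (real k + 1)\<^sup>2 + c * 2 ^ (k + 2)"
    \<comment> \<open>The bound on \<open>v\<close> is the larger root of
      \<open>(v - 1) * (v + k) = c * 2 ^ k\<close>. The square root is isolated and both sides,
      which are nonnegative, are squared.\<close>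
    have "2 * real v + real k - 1 < sqrt s"
      using v unfolding s_def[symmetric] by (simp add: field_simps)
    moreover have "0 \<le> 2 * real v + real k - 1"
      using assms(1) by simp
    ultimately have "(2 * real v + real k - 1)\<^sup>2 < (sqrt s)\<^sup>2"
      by (intro power_strict_mono) auto
    also have "\<dots> = s"
      using c by (simp add: s_def)
    finally have vk: "(real v - 1) * (real v + real k) < c * 2 ^ k"
      by (simp add: s_def power2_eq_square algebra_simps)
    have first: "weight ?F {} {} + weight (through x ?F) {} {} < 1" if x: "x \<in> X" for x
    proof -
      define r where "r = real (card (through x ?F))"
      have wR: "weight (through x ?F) {} {} = r / 2 ^ k"
        unfolding r_def by (rule weight_uniform) (use F in auto)
      have "real (card (through x ?F) * (k - 1)) = real (v - 1)"
        using bibd_replication[OF assms(3) x] by simp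
      then have "r * (real k - 1) = real v - 1"
        using assms(1) False by (simp add: r_def of_nat_diff)
      then have "r * c = real k * (real v - 1)"
        unfolding c_def by (metis mult.left_commute)
      \<comment> \<open>Adding the two counts gives \<open>c * (b + r) = (v - 1) * (v + k)\<close>,
        the left side of \<open>vk\<close>.\<close>
      then have "c * (b + r) < c * 2 ^ k"
        using vk b by (simp add: algebra_simps)
      then have "b + r < 2 ^ k"
        using c by simp
      then show ?thesis
        by (simp add: wF wR add_divide_distrib[symmetric])
    qed
    obtain x where "x \<in> X"
      using False X by fastforce
    then have "weight ?F {} {} < 1"
      using first[of x] weight_nonneg[of "through x ?F" "{}" "{}"] by linarith
    then show ?thesis
      by (intro breaker_win_Erdos_Selfridge) (use X F first in auto)
  qed
  show ?thesis
    using maker breaker unfolding c_def by blast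
qed

end
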